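(* Let $X_1,\ldots,X_n,Y_1,\ldots,Y_n$ be random variables with distributions $F_1,\ldots,F_n,G_1,\ldots,G_n$ respectively, all from the class $\mathcal{D}\cap\mathcal{L}$. Suppose that $X_1,\ldots,X_n,Y_1,\ldots,Y_n$ are generalized tail asymptotically independent (GTAI), that $(X_k,Y_l)\in(\mathcal{D}\cap\mathcal{L})^{(2)}$ for all $k,l\in\{1,\ldots,n\}$, that $X_1,\ldots,X_n$ are tail asymptotically independent (TAI) and that $Y_1,\ldots,Y_n$ are TAI. For initial capitals $x,y>0$ let $\psi_{and}(x,y,n)=\mathbf{P}[T_{and}\le n]$ be the ruin probability defined in the context. Then $$\psi_{and}(x,y,n)\sim\sum_{k=1}^n\sum_{l=1}^n\mathbf{P}[X_k>x,\ Y_l>y],\qquad x\wedge y\to\infty.$$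
   Context: Risk model: the surplus processes of the two portfolios are $U_1(k,x)=x-\sum_{i=1}^kX_i$ and $U_2(k,y)=y-\sum_{j=1}^kY_j$ for $1\le k\le n$, with $U_1(0,x)=x$, $U_2(0,y)=y$. The individual ruin times are $T_1(x)=\inf\{1\le k\le n: U_1(k,x)<0\}$ and $T_2(y)=\inf\{1\le k\le n:U_2(k,y)<0\}$ (with $\inf\emptyset=\infty$), and $T_{and}=\max\{T_1(x),T_2(y)\}$ is the first moment by which both portfolios have been with negative surplus, not necessarily simultaneously. Notation: $x\wedge y=\min\{x,y\}$; $f(x,y)\sim g(x,y)$ as $x\wedge y\to\infty$ means $\lim_{x\wedge y\to\infty} f(x,y)/g(x,y)=1$. For a distribution $F$ on $\mathbb{R}$, $\overline F=1-F$; all distributions satisfy $\overline F(x)>0$ for all $x\ge 0$. Joint tails appearing in denominators or as conditioning events are implicitly assumed positive. One-dimensional classes: $F\in\mathcal{L}$ (long-tailed) if $\lim_{x\to\infty}\overline F(x-a)/\overline F(x)=1$ for every $a>0$. $F\in\mathcal{D}$ (dominatedly varying) if $\limsup_{x\to\infty}\overline F(bx)/\overline F(x)<\infty$ for some (equivalently all) $b\in(0,1)$. Two-dimensional classes: let $(X,Y)$ have marginal distributions $F,G$. We write $(X,Y)\in\mathcal{L}^{(2)}$ if $F,G\in\mathcal{L}$ and $\lim_{x\wedge y\to\infty}\mathbf{P}[X>x-a_1,Y>y-a_2]/\mathbf{P}[X>x,Y>y]=1$ for every $(a_1,a_2)\in[0,\infty)^2\setminus\{(0,0)\}$. We write $(X,Y)\in\mathcal{D}^{(2)}$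 if $F,G\in\mathcal{D}$ and $\limsup_{x\wedge y\to\infty}\mathbf{P}[X>b_1x,Y>b_2y]/\mathbf{P}[X>x,Y>y]<\infty$ for some (equivalently all) $(b_1,b_2)\in(0,1)^2$. Finally $(\mathcal{D}\cap\mathcal{L})^{(2)}=\mathcal{D}^{(2)}\cap\mathcal{L}^{(2)}$. GTAI: $X_1,\ldots,X_n,Y_1,\ldots,Y_m$ are GTAI if (1) $\lim_{\min\{x_i,x_k,y_j\}\to\infty}\mathbf{P}[|X_i|>x_i\mid X_k>x_k,Y_j>y_j]=0$ for all $1\le i\ne k\le n$, $1\le j\le m$; and (2) $\lim_{\min\{x_i,y_k,y_j\}\to\infty}\mathbf{P}[|Y_j|>y_j\mid X_i>x_i,Y_k>y_k]=0$ for all $1\le j\ne k\le m$, $1\le i\le n$. TAI: $X_1,\ldots,X_n$ are TAI if $\lim_{x_i\wedge x_j\to\infty}\mathbf{P}[|X_i|>x_i\mid X_j>x_j]=0$ for all $i\ne j$ in $\{1,\ldots,n\}$. *)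

theory Defs
  imports "HOL-Probability.Probability"
begin

text \<open>
  The limit \<open>x \<and> y \<rightarrow> \<infinity>\<close> of a minimum of real variables is taken along a product of copies of
  \<^term>\<open>at_top\<close>: a property holds eventually there iff it holds whenever all coordinates are
  large enough, with no relation between the speeds of growth.
\<close>

definition tail :: "real measure \<Rightarrow> real \<Rightarrow> real" where
  "tail D x = 1 - cdf D x"

definition long_tailed :: "real measure \<Rightarrow> bool" where
  "long_tailed D \<longleftrightarrow> (\<forall>a>0. ((\<lambda>x. tail D (x - a) / tail D x) \<longlongrightarrow> 1) at_top)"

definition dominatedly_varying :: "real measure \<Rightarrow> bool" where
  "dominatedly_varying D \<longleftrightarrow>
     (\<exists>b\<in>{0<..<1}. Limsup at_top (\<lambda>x. ereal (tail D (b * x) / tail D x)) < \<infinity>)"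

definition joint_tail ::
  "'a measure \<Rightarrow> ('a \<Rightarrow> real) \<Rightarrow> ('a \<Rightarrow> real) \<Rightarrow> real \<Rightarrow> real \<Rightarrow> real" where
  "joint_tail M X Y x y = \<P>(\<omega> in M. X \<omega> > x \<and> Y \<omega> > y)"

definition long_tailed2 :: "'a measure \<Rightarrow> ('a \<Rightarrow> real) \<Rightarrow> ('a \<Rightarrow> real) \<Rightarrow> bool" where
  "long_tailed2 M X Y \<longleftrightarrow>
     long_tailed (distr M borel X) \<and> long_tailed (distr M borel Y) \<and>
     (\<forall>a1\<ge>0. \<forall>a2\<ge>0. (a1, a2) \<noteq> (0, 0) \<longrightarrow>
        ((\<lambda>(x, y). joint_tail M X Y (x - a1) (y - a2) / joint_tail M X Y x y) \<longlongrightarrow> 1)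
          (at_top \<times>\<^sub>F at_top))"

definition dominatedly_varying2 :: "'a measure \<Rightarrow> ('a \<Rightarrow> real) \<Rightarrow> ('a \<Rightarrow> real) \<Rightarrow> bool" where
  "dominatedly_varying2 M X Y \<longleftrightarrow>
     dominatedly_varying (distr M borel X) \<and> dominatedly_varying (distr M borel Y) \<and>
     (\<exists>b1\<in>{0<..<1}. \<exists>b2\<in>{0<..<1}.
        Limsup (at_top \<times>\<^sub>F at_top)
          (\<lambda>(x, y). ereal (joint_tail M X Y (b1 * x) (b2 * y) / joint_tail M X Y x y)) < \<infinity>)"

text \<open>Tail asymptotic independence of \<open>X\<^sub>1, \<dots>, X\<^sub>n\<close>.\<close>

definition TAI :: "'a measure \<Rightarrow> nat \<Rightarrow> (nat \<Rightarrow> 'a \<Rightarrow> real) \<Rightarrow> bool" where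
  "TAI M n X \<longleftrightarrow>
     (\<forall>i\<in>{1..n}. \<forall>j\<in>{1..n}. i \<noteq> j \<longrightarrow>
        ((\<lambda>(xi, xj). \<P>(\<omega> in M. \<bar>X i \<omega>\<bar> > xi \<bar> X j \<omega> > xj)) \<longlongrightarrow> 0)
          (at_top \<times>\<^sub>F at_top))"

text \<open>Generalized tail asymptotic independence of \<open>X\<^sub>1, \<dots>, X\<^sub>n, Y\<^sub>1, \<dots>, Y\<^sub>m\<close>.\<close>

definition GTAI ::
  "'a measure \<Rightarrow> nat \<Rightarrow> nat \<Rightarrow> (nat \<Rightarrow> 'a \<Rightarrow> real) \<Rightarrow> (nat \<Rightarrow> 'a \<Rightarrow> real) \<Rightarrow> bool" where
  "GTAI M n m X Y \<longleftrightarrow>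
     (\<forall>i\<in>{1..n}. \<forall>k\<in>{1..n}. \<forall>j\<in>{1..m}. i \<noteq> k \<longrightarrow>
        ((\<lambda>(xi, xk, yj). \<P>(\<omega> in M. \<bar>X i \<omega>\<bar> > xi \<bar> X k \<omega> > xk \<and> Y j \<omega> > yj)) \<longlongrightarrow> 0)
          (at_top \<times>\<^sub>F at_top \<times>\<^sub>F at_top)) \<and>
     (\<forall>j\<in>{1..m}. \<forall>k\<in>{1..m}. \<forall>i\<in>{1..n}. j \<noteq> k \<longrightarrow>
        ((\<lambda>(xi, yk, yj). \<P>(\<omega> in M. \<bar>Y j \<omega>\<bar> > yj \<bar> X i \<omega> > xi \<and> Y k \<omega> > yk)) \<longlongrightarrow> 0)
          (at_top \<times>\<^sub>F at_top \<times>\<^sub>F at_top))"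

definition surplus :: "(nat \<Rightarrow> 'a \<Rightarrow> real) \<Rightarrow> nat \<Rightarrow> real \<Rightarrow> 'a \<Rightarrow> real" where
  "surplus X k x \<omega> = x - (\<Sum>i=1..k. X i \<omega>)"

text \<open>The infimum is taken in \<^typ>\<open>enat\<close>, where the empty set has infimum \<open>\<infinity>\<close>.\<close>

definition ruin_time :: "nat \<Rightarrow> (nat \<Rightarrow> 'a \<Rightarrow> real) \<Rightarrow> real \<Rightarrow> 'a \<Rightarrow> enat" where
  "ruin_time n X x \<omega> = Inf (enat ` {k\<in>{1..n}. surplus X k x \<omega> < 0})"

definition T_and ::
  "nat \<Rightarrow> (nat \<Rightarrow> 'a \<Rightarrow> real) \<Rightarrow> (nat \<Rightarrow> 'a \<Rightarrow> real) \<Rightarrow> real \<Rightarrow> real \<Rightarrow> 'a \<Rightarrow> enat" where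
  "T_and n X Y x y \<omega> = max (ruin_time n X x \<omega>) (ruin_time n Y y \<omega>)"

definition psi_and ::
  "'a measure \<Rightarrow> (nat \<Rightarrow> 'a \<Rightarrow> real) \<Rightarrow> (nat \<Rightarrow> 'a \<Rightarrow> real) \<Rightarrow> real \<Rightarrow> real \<Rightarrow> nat \<Rightarrow> real" where
  "psi_and M X Y x y n = \<P>(\<omega> in M. T_and n X Y x y \<omega> \<le> enat n)"

end

theory Submission
  imports Defs
begin

text \<open>
  Write \<open>J k l x y\<close> for \<open>P[X\<^sub>k > x, Y\<^sub>l > y]\<close>. The principle is that of a single big jump in each
  portfolio: a partial sum of the \<open>X\<^sub>i\<close> exceeds a large level essentially only because one \<open>X\<^sub>k\<close> does,
  and likewise for the \<open>Y\<^sub>j\<close>. The corrections are measured by the event \<open>crowded\<close>: \<open>X\<^sub>k\<close> and \<open>Y\<^sub>l\<close> are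
  large, and yet another \<open>|X\<^sub>i|\<close> or \<open>|Y\<^sub>j|\<close> exceeds a level \<open>a\<close>. By generalized tail asymptotic
  independence its probability is at most \<open>\<delta> J k l x y\<close> as soon as \<open>a\<close>, \<open>x\<close>, \<open>y\<close> are all beyond
  one threshold (\<open>crowded_negligible\<close>). As no relation between the three levels is required, \<open>a\<close> may
  stay \<^emph>\<open>constant\<close> while \<open>x\<close> and \<open>y\<close> grow; this is what makes both bounds below work.

  Upper bound (\<open>prob_both_ruined_le\<close>): if a partial sum exceeds \<open>x\<close>, then the largest summand \<open>X\<^sub>k\<close>
  exceeds \<open>x / n\<close>, and it even exceeds \<open>x - a\<close> unless another summand has absolute value above
  \<open>a / n\<close>. Hence joint ruin forces \<open>X\<^sub>k > x - a\<close> and \<open>Y\<^sub>l > y - a\<close> for some \<open>k\<close>, \<open>l\<close>, or a crowded event at the levels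
  \<open>x / n\<close> and \<open>y / n\<close>. Joint long-tailedness turns \<open>J k l (x - a) (y - a)\<close> into
  \<open>J k l x y\<close>, and joint dominated variation compares these levels with \<open>x\<close> and \<open>y\<close> at
  the cost of a constant, which the factor \<open>\<delta>\<close> absorbs.

  Lower bound (\<open>prob_both_ruined_ge\<close>): if \<open>X\<^sub>k > x + a\<close> and \<open>Y\<^sub>l > y + a\<close> without
  crowding at level \<open>a / n\<close>, the other summands cannot pull the full sums below \<open>x\<close> and \<open>y\<close>. These events are pairwise disjoint in \<open>(k, l)\<close>, so
  their probabilities add up without an inclusion-exclusion correction, and joint long-tailedness
  removes the shift by \<open>a\<close>.
\<close>

section \<open>Limits along products of real half-lines\<close>

lemma eventually_at_top_prod_iff:
  "eventually P (at_top \<times>\<^sub>F (at_top :: real filter)) \<longleftrightarrow> (\<exists>K>0. \<forall>x\<ge>K. \<forall>y\<ge>(K::real). P (x, y))"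
proof
  assume "eventually P (at_top \<times>\<^sub>F (at_top :: real filter))"
  then obtain Q R where QR: "eventually Q (at_top :: real filter)" "eventually R (at_top :: real filter)"
      "\<And>x y. Q x \<Longrightarrow> R y \<Longrightarrow> P (x, y)"
    by (auto simp: eventually_prod_filter)
  then obtain A B where "\<forall>x\<ge>A. Q x" "\<forall>y\<ge>B. R y"
    by (auto simp: eventually_at_top_linorder)
  then show "\<exists>K>0. \<forall>x\<ge>K. \<forall>y\<ge>K. P (x, y)"
    using QR(3) by (intro exI[of _ "max 1 (max A B)"]) auto
next
  assume "\<exists>K>0. \<forall>x\<ge>K. \<forall>y\<ge>K. P (x, y)"
  then obtain K where "\<forall>x\<ge>K. \<forall>y\<ge>K. P (x, y)" by auto
  then show "eventually P (at_top \<times>\<^sub>F at_top)"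
    unfolding eventually_prod_filter
    by (intro exI[of _ "\<lambda>x. x \<ge> K"]) (auto intro: eventually_ge_at_top)
qed

lemma eventually_at_top_prodE:
  assumes "\<forall>\<^sub>F (x, y) in at_top \<times>\<^sub>F (at_top :: real filter). P x y"
  obtains K :: real where "0 < K" "\<And>x y. K \<le> x \<Longrightarrow> K \<le> y \<Longrightarrow> P x y"
  using assms that unfolding eventually_at_top_prod_iff by auto

lemma eventually_at_top_prod3E:
  assumes "\<forall>\<^sub>F (a, x, y) in at_top \<times>\<^sub>F at_top \<times>\<^sub>F (at_top :: real filter). P a x y"
  obtains K :: real where "0 < K" "\<And>a x y. K \<le> a \<Longrightarrow> K \<le> x \<Longrightarrow> K \<le> y \<Longrightarrow> P a x y"
proof -
  obtain Q R where QR: "eventually Q (at_top :: real filter)"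
      "eventually R (at_top \<times>\<^sub>F (at_top :: real filter))" "\<And>a x y. Q a \<Longrightarrow> R (x, y) \<Longrightarrow> P a x y"
    using assms by (auto simp: eventually_prod_filter[of _ at_top "at_top \<times>\<^sub>F at_top"])
  obtain A where "\<And>a. A \<le> a \<Longrightarrow> Q a" using QR(1) by (auto simp: eventually_at_top_linorder)
  moreover obtain B where "B > 0" "\<And>x y. B \<le> x \<Longrightarrow> B \<le> y \<Longrightarrow> R (x, y)"
    using QR(2) by (auto simp: eventually_at_top_prod_iff)
  ultimately show ?thesis
    using QR(3) by (intro that[of "max A B"]) auto
qed

section \<open>One big summand in a large sum\<close>

text \<open>
  Only the positive parts can push a partial sum up, and their sum over all of \<open>I\<close> is at least as
  large. One of them must reach the average \<open>x / card I\<close>. If it stays below \<open>x - a\<close>, the remaining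
  positive parts have to supply more than \<open>a\<close> together, so one of them exceeds \<open>a / card I\<close>.
\<close>
lemma partial_sum_exceeds:
  fixes u :: "'i \<Rightarrow> real"
  assumes "finite I" "A \<subseteq> I" "0 \<le> x" "0 \<le> a" and gt: "x < sum u A"
  shows "\<exists>k\<in>I. x / card I < u k \<and> (x - a < u k \<or> (\<exists>i\<in>I - {k}. a / card I < \<bar>u i\<bar>))"
proof -
  let ?p = "\<lambda>i. max (u i) 0"
  have "I \<noteq> {}" using assms by auto
  then have card: "card I > 0" using \<open>finite I\<close> by (simp add: card_gt_0_iff)
  have "sum u A \<le> sum ?p A" by (intro sum_mono) auto
  also have "\<dots> \<le> sum ?p I" by (intro sum_mono2) (use assms in auto)
  finally have pos: "x < sum ?p I" using gt by linarith
  have "\<exists>k\<in>I. x / card I < ?p k"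
  proof (rule ccontr)
    assume "\<not> ?thesis"
    then have "sum ?p I \<le> of_nat (card I) * (x / card I)"
      by (intro sum_bounded_above) force
    then show False using pos card by simp
  qed
  then obtain k where k: "k \<in> I" "x / card I < ?p k" by blast
  have "0 \<le> x / card I" using assms(3) by simp
  then have uk: "x / card I < u k" "?p k = u k" using k(2) by linarith+
  have "\<exists>i\<in>I - {k}. a / card I < \<bar>u i\<bar>" if "\<not> x - a < u k"
  proof (rule ccontr)
    assume neg: "\<not> ?thesis"
    have "sum ?p (I - {k}) \<le> of_nat (card (I - {k})) * (a / card I)"
      by (intro sum_bounded_above) (use neg \<open>0 \<le> a\<close> in force)
    also have "\<dots> \<le> of_nat (card I) * (a / card I)"
      using \<open>0 \<le> a\<close> \<open>finite I\<close> by (intro mult_right_mono) (auto intro: card_mono)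
    finally have "sum ?p (I - {k}) \<le> a" using card by simp
    moreover have "sum ?p I = u k + sum ?p (I - {k})"
      using k(1) \<open>finite I\<close> uk(2) by (simp add: sum.remove)
    ultimately show False using pos that by linarith
  qed
  then show ?thesis using k(1) uk(1) by blast
qed

text \<open>The counterpart from below: the other summands together lower the sum by at most \<open>a\<close>.\<close>
lemma single_big_summand:
  fixes u :: "'i \<Rightarrow> real"
  assumes "finite I" "k \<in> I" "0 \<le> a" and big: "x + a < u k"
    and small: "\<And>i. i \<in> I - {k} \<Longrightarrow> \<bar>u i\<bar> \<le> a / card I"
  shows "x < sum u I"
proof -
  have card: "card I > 0" using assms by (auto simp: card_gt_0_iff)
  have "sum (\<lambda>i. - u i) (I - {k}) \<le> of_nat (card (I - {k})) * (a / card I)"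
    by (intro sum_bounded_above) (use small in force)
  also have "\<dots> \<le> of_nat (card I) * (a / card I)"
    using \<open>0 \<le> a\<close> \<open>finite I\<close> by (intro mult_right_mono) (auto intro: card_mono)
  finally have "- sum u (I - {k}) \<le> a" using card by (simp add: sum_negf)
  moreover have "sum u I = u k + sum u (I - {k})"
    using assms by (simp add: sum.remove)
  ultimately show ?thesis using big by linarith
qed

text \<open>
  Each portfolio has its own time of ruin, so the event concerns the two maxima of partial sums
  separately; no common index appears.
\<close>
lemma T_and_le_iff:
  "T_and n X Y x y \<omega> \<le> enat n \<longleftrightarrow>
     (\<exists>k\<in>{1..n}. x < (\<Sum>i=1..k. X i \<omega>)) \<and> (\<exists>l\<in>{1..n}. y < (\<Sum>i=1..l. Y i \<omega>))"
proof -
  have "ruin_time n Z z \<omega> \<le> enat n \<longleftrightarrow> (\<exists>k\<in>{1..n}. z < (\<Sum>i=1..k. Z i \<omega>))"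
    for Z :: "nat \<Rightarrow> 'a \<Rightarrow> real" and z
  proof
    assume le: "ruin_time n Z z \<omega> \<le> enat n"
    have "{k\<in>{1..n}. surplus Z k z \<omega> < 0} \<noteq> {}"
    proof
      assume "{k\<in>{1..n}. surplus Z k z \<omega> < 0} = {}"
      then have "ruin_time n Z z \<omega> = \<infinity>"
        unfolding ruin_time_def by (simp only: image_empty Inf_empty top_enat_def)
      then show False using le by simp
    qed
    then show "\<exists>k\<in>{1..n}. z < (\<Sum>i=1..k. Z i \<omega>)" by (auto simp: surplus_def)
  next
    assume "\<exists>k\<in>{1..n}. z < (\<Sum>i=1..k. Z i \<omega>)"
    then obtain k where k: "k \<in> {1..n}" "surplus Z k z \<omega> < 0" by (auto simp: surplus_def)
    then have "ruin_time n Z z \<omega> \<le> enat k" unfolding ruin_time_def by (auto intro: Inf_lower)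
    also have "\<dots> \<le> enat n" using k by simp
    finally show "ruin_time n Z z \<omega> \<le> enat n" .
  qed
  then show ?thesis by (simp add: T_and_def)
qed

section \<open>Shifting and scaling the arguments of a joint tail\<close>

context prob_space
begin

lemma joint_tail_antimono:
  assumes [measurable]: "X \<in> borel_measurable M" "Y \<in> borel_measurable M"
    and "x \<le> x'" "y \<le> y'"
  shows "joint_tail M X Y x' y' \<le> joint_tail M X Y x y"
  unfolding joint_tail_def by (intro finite_measure_mono) (use assms(3,4) in auto)

lemma joint_tail_nonneg: "0 \<le> joint_tail M X Y x y"
  by (simp add: joint_tail_def)

text \<open>
  Dominated variation is given for one pair of factors only. By monotonicity of the joint tail the
  larger of the two factors serves in both coordinates, and a power of it drops below any \<open>c > 0\<close>;
  iterating the bound along this power gives the constant.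
\<close>
lemma joint_tail_scale_bound:
  assumes [measurable]: "X \<in> borel_measurable M" "Y \<in> borel_measurable M"
    and pos: "\<And>x y. 0 \<le> x \<Longrightarrow> 0 \<le> y \<Longrightarrow> 0 < joint_tail M X Y x y"
    and D: "dominatedly_varying2 M X Y" and "0 < c"
  shows "\<exists>C\<ge>0. \<forall>\<^sub>F (x, y) in at_top \<times>\<^sub>F at_top.
           joint_tail M X Y (c * x) (c * y) \<le> C * joint_tail M X Y x y"
proof -
  let ?J = "joint_tail M X Y"
  obtain b1 b2 where b12: "0 < b1" "b1 < 1" "0 < b2" "b2 < 1" and
    lim: "Limsup (at_top \<times>\<^sub>F at_top) (\<lambda>(x, y). ereal (?J (b1 * x) (b2 * y) / ?J x y)) < \<infinity>"
    using D unfolding dominatedly_varying2_def by auto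
  (* A common factor makes the bound iterable: each step scales both coordinates alike. *)
  define b where "b = max b1 b2"
  have b: "0 < b" "b < 1" using b12 by (auto simp: b_def)
  obtain B :: ereal where B:
      "Limsup (at_top \<times>\<^sub>F at_top) (\<lambda>(x, y). ereal (?J (b1 * x) (b2 * y) / ?J x y)) < B" "B < \<infinity>"
    using dense[OF lim] by blast
  (* The maximum makes C a nonnegative real bound whatever extended real B is. *)
  define C where "C = max 1 (real_of_ereal B)"
  have BC: "B \<le> ereal C" using B by (cases B) (auto simp: C_def)
  have "\<forall>\<^sub>F p in at_top \<times>\<^sub>F at_top. (\<lambda>(x, y). ereal (?J (b1 * x) (b2 * y) / ?J x y)) p < B"
    using B(1) by (rule Limsup_lessD)
  then obtain K where K: "K > 0"
      and "\<forall>x\<ge>K. \<forall>y\<ge>K. ereal (?J (b1 * x) (b2 * y) / ?J x y) < B"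
    by (auto simp: eventually_at_top_prod_iff)
  then have ratio: "?J (b1 * x) (b2 * y) / ?J x y \<le> C" if "x \<ge> K" "y \<ge> K" for x y
    using that BC by (metis ereal_less_eq(3) less_imp_le order.strict_trans2)
  have step: "?J (b * x) (b * y) \<le> C * ?J x y" if "x \<ge> K" "y \<ge> K" for x y
  proof -
    have "?J (b * x) (b * y) \<le> ?J (b1 * x) (b2 * y)"
      using that K by (intro joint_tail_antimono mult_right_mono) (auto simp: b_def)
    also have "\<dots> \<le> C * ?J x y"
      using ratio[OF that] pos[of x y] that K by (simp add: divide_le_eq)
    finally show ?thesis .
  qed
  (* The m-th step evaluates the bound at b ^ m * x, so x has to grow with m to stay beyond K. *)
  have iter: "?J (b ^ m * x) (b ^ m * y) \<le> C ^ m * ?J x y"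
    if "x \<ge> K / b ^ m" "y \<ge> K / b ^ m" for m x y
    using that
  proof (induction m)
    case 0
    then show ?case by simp
  next
    case (Suc m)
    have 1: "b ^ m * x \<ge> K / b" "b ^ m * y \<ge> K / b"
      using Suc.prems b by (auto simp: field_simps)
    have "K / b \<ge> K" using K b by (simp add: field_simps)
    have 2: "x \<ge> K / b ^ m" "y \<ge> K / b ^ m"
      using order_trans[OF \<open>K / b \<ge> K\<close> 1(1)] order_trans[OF \<open>K / b \<ge> K\<close> 1(2)] b
      by (auto simp: field_simps)
    have "?J (b ^ Suc m * x) (b ^ Suc m * y) = ?J (b * (b ^ m * x)) (b * (b ^ m * y))"
      by (simp add: mult.assoc)
    also have "\<dots> \<le> C * ?J (b ^ m * x) (b ^ m * y)"
      using 1 \<open>K / b \<ge> K\<close> by (intro step) linarith+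
    also have "\<dots> \<le> C * (C ^ m * ?J x y)"
      using Suc.IH[OF 2] by (intro mult_left_mono) (auto simp: C_def)
    finally show ?case by (simp add: mult.assoc)
  qed
  obtain m where m: "b ^ m < c" using real_arch_pow_inv[OF \<open>0 < c\<close> b(2)] by blast
  have "?J (c * x) (c * y) \<le> C ^ m * ?J x y" if "x \<ge> K / b ^ m" "y \<ge> K / b ^ m" for x y
  proof -
    have "K / b ^ m > 0" using K b by simp
    then have "?J (c * x) (c * y) \<le> ?J (b ^ m * x) (b ^ m * y)"
      using that m by (intro joint_tail_antimono mult_right_mono) auto
    then show ?thesis using iter[OF that] by linarith
  qed
  then have "\<forall>\<^sub>F (x, y) in at_top \<times>\<^sub>F at_top. ?J (c * x) (c * y) \<le> C ^ m * ?J x y"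
    using K b by (auto simp: eventually_at_top_prod_iff intro!: exI[of _ "K / b ^ m"])
  then show ?thesis by (intro exI[of _ "C ^ m"]) (auto simp: C_def)
qed

text \<open>
  Applied at \<open>(x + a, y + a)\<close> this also bounds \<open>J k l x y\<close> by \<open>(1 + \<delta>) J k l (x + a) (y + a)\<close>, so it
  serves the upper and the lower estimate.
\<close>
lemma joint_tail_shift_bound:
  assumes pos: "\<And>x y. 0 \<le> x \<Longrightarrow> 0 \<le> y \<Longrightarrow> 0 < joint_tail M X Y x y"
    and L: "long_tailed2 M X Y" and "0 < a" "0 < \<delta>"
  shows "\<forall>\<^sub>F (x, y) in at_top \<times>\<^sub>F at_top.
           joint_tail M X Y (x - a) (y - a) \<le> (1 + \<delta>) * joint_tail M X Y x y"
proof -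
  let ?J = "joint_tail M X Y"
  have "((\<lambda>(x, y). ?J (x - a) (y - a) / ?J x y) \<longlongrightarrow> 1) (at_top \<times>\<^sub>F at_top)"
    using L \<open>0 < a\<close> by (simp add: long_tailed2_def)
  then have "\<forall>\<^sub>F p in at_top \<times>\<^sub>F at_top. (\<lambda>(x, y). ?J (x - a) (y - a) / ?J x y) p < 1 + \<delta>"
    using \<open>0 < \<delta>\<close> by (intro order_tendstoD) auto
  then obtain K where K: "K > 0"
      "\<And>x y. x \<ge> K \<Longrightarrow> y \<ge> K \<Longrightarrow> ?J (x - a) (y - a) / ?J x y < 1 + \<delta>"
    by (auto simp: eventually_at_top_prod_iff)
  have "?J (x - a) (y - a) \<le> (1 + \<delta>) * ?J x y" if "x \<ge> K" "y \<ge> K" for x y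
    using K(2)[OF that] pos[of x y] that K(1) by (simp add: divide_less_eq)
  then show ?thesis using K(1) by (auto simp: eventually_at_top_prod_iff)
qed

text \<open>
  If the condition has probability 0, the conditional probability is 0 by the convention for
  division and says nothing; the claim then holds because its left-hand side vanishes as well.
\<close>
lemma cond_prob_lessD:
  assumes "Measurable.pred M P" "Measurable.pred M Q" and less: "\<P>(\<omega> in M. P \<omega> \<bar> Q \<omega>) < \<delta>"
  shows "\<P>(\<omega> in M. P \<omega> \<and> Q \<omega>) \<le> \<delta> * \<P>(\<omega> in M. Q \<omega>)"
proof (cases "\<P>(\<omega> in M. Q \<omega>) = 0")
  case True
  have "\<P>(\<omega> in M. P \<omega> \<and> Q \<omega>) \<le> \<P>(\<omega> in M. Q \<omega>)"
    using assms by (intro finite_measure_mono) (auto simp: pred_def)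
  then show ?thesis using True by simp
next
  case False
  then have "\<P>(\<omega> in M. Q \<omega>) > 0" by (simp add: zero_less_measure_iff)
  then show ?thesis using less by (simp add: cond_prob_def divide_less_eq)
qed

end

section \<open>Joint ruin and crowded events\<close>

text \<open>
  The exceptional event of the single big jump principle. One level \<open>a\<close> is used for all of the
  other summands of both portfolios, so that it can be kept constant while \<open>x\<close> and \<open>y\<close> grow.
\<close>
definition crowded ::
  "'a measure \<Rightarrow> (nat \<Rightarrow> 'a \<Rightarrow> real) \<Rightarrow> (nat \<Rightarrow> 'a \<Rightarrow> real) \<Rightarrow> nat \<Rightarrow> nat \<Rightarrow> nat \<Rightarrow> real \<Rightarrow> real \<Rightarrow> real \<Rightarrow> 'a set"
  where "crowded M X Y n k l a x y = {\<omega>\<in>space M. X k \<omega> > x \<and> Y l \<omega> > y \<and>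
     ((\<exists>i\<in>{1..n} - {k}. \<bar>X i \<omega>\<bar> > a) \<or> (\<exists>j\<in>{1..n} - {l}. \<bar>Y j \<omega>\<bar> > a))}"

definition both_ruined ::
  "'a measure \<Rightarrow> (nat \<Rightarrow> 'a \<Rightarrow> real) \<Rightarrow> (nat \<Rightarrow> 'a \<Rightarrow> real) \<Rightarrow> nat \<Rightarrow> real \<Rightarrow> real \<Rightarrow> 'a set"
  where "both_ruined M X Y n x y = {\<omega>\<in>space M.
     (\<exists>k\<in>{1..n}. x < (\<Sum>i=1..k. X i \<omega>)) \<and> (\<exists>l\<in>{1..n}. y < (\<Sum>i=1..l. Y i \<omega>))}"

locale two_portfolios = prob_space M
  for M :: "'a measure" +
  fixes X Y :: "nat \<Rightarrow> 'a \<Rightarrow> real" and n :: nat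
  assumes X_measurable: "\<And>k. k \<in> {1..n} \<Longrightarrow> X k \<in> borel_measurable M"
    and Y_measurable: "\<And>l. l \<in> {1..n} \<Longrightarrow> Y l \<in> borel_measurable M"
begin

abbreviation J :: "nat \<Rightarrow> nat \<Rightarrow> real \<Rightarrow> real \<Rightarrow> real" where
  "J k l \<equiv> joint_tail M (X k) (Y l)"

lemma exceed_sets:
  assumes "k \<in> {1..n}" "l \<in> {1..n}"
  shows "{\<omega>\<in>space M. X k \<omega> > x \<and> Y l \<omega> > y} \<in> events"
proof -
  note [measurable] = X_measurable[OF assms(1)] Y_measurable[OF assms(2)]
  show ?thesis by measurable
qed

lemma other_X_sets:
  assumes "i \<in> {1..n}" "k \<in> {1..n}" "l \<in> {1..n}"
  shows "{\<omega>\<in>space M. \<bar>X i \<omega>\<bar> > a \<and> X k \<omega> > x \<and> Y l \<omega> > y} \<in> events"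
proof -
  note [measurable] = X_measurable[OF assms(1)] X_measurable[OF assms(2)] Y_measurable[OF assms(3)]
  show ?thesis by measurable
qed

lemma other_Y_sets:
  assumes "j \<in> {1..n}" "k \<in> {1..n}" "l \<in> {1..n}"
  shows "{\<omega>\<in>space M. \<bar>Y j \<omega>\<bar> > a \<and> X k \<omega> > x \<and> Y l \<omega> > y} \<in> events"
proof -
  note [measurable] = Y_measurable[OF assms(1)] X_measurable[OF assms(2)] Y_measurable[OF assms(3)]
  show ?thesis by measurable
qed

lemma crowded_eq_Union:
  "crowded M X Y n k l a x y =
     (\<Union>i\<in>{1..n} - {k}. {\<omega>\<in>space M. \<bar>X i \<omega>\<bar> > a \<and> X k \<omega> > x \<and> Y l \<omega> > y}) \<union>
     (\<Union>j\<in>{1..n} - {l}. {\<omega>\<in>space M. \<bar>Y j \<omega>\<bar> > a \<and> X k \<omega> > x \<and> Y l \<omega> > y})"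
  by (auto simp: crowded_def)

lemma crowded_sets:
  assumes "k \<in> {1..n}" "l \<in> {1..n}"
  shows "crowded M X Y n k l a x y \<in> events"
  unfolding crowded_eq_Union
  using assms by (intro sets.Un sets.finite_UN other_X_sets other_Y_sets) auto

lemma both_ruined_sets: "both_ruined M X Y n x y \<in> events"
proof -
  have partial_sums: "{\<omega>\<in>space M. z < (\<Sum>i=1..k. Z i \<omega>)} \<in> events"
    if "k \<in> {1..n}" "\<And>i. i \<in> {1..n} \<Longrightarrow> Z i \<in> borel_measurable M"
    for k z and Z :: "nat \<Rightarrow> 'a \<Rightarrow> real"
  proof -
    have [measurable]: "(\<lambda>\<omega>. \<Sum>i=1..k. Z i \<omega>) \<in> borel_measurable M"
      using that by (intro borel_measurable_sum) auto
    show ?thesis by measurable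
  qed
  have "both_ruined M X Y n x y =
      (\<Union>k\<in>{1..n}. {\<omega>\<in>space M. x < (\<Sum>i=1..k. X i \<omega>)}) \<inter>
      (\<Union>l\<in>{1..n}. {\<omega>\<in>space M. y < (\<Sum>i=1..l. Y i \<omega>)})"
    by (auto simp: both_ruined_def)
  also have "\<dots> \<in> events"
    by (intro sets.Int sets.finite_UN partial_sums X_measurable Y_measurable finite_atLeastAtMost)
  finally show ?thesis .
qed

text \<open>
  This is what generalized tail asymptotic independence is used for. Given that \<open>X\<^sub>k\<close> and \<open>Y\<^sub>l\<close> are
  large, each of the fewer than \<open>2 n\<close> other variables exceeds \<open>a\<close> with small conditional
  probability, and the threshold is the same for all of them as there are finitely many.
\<close>
lemma crowded_negligible:
  assumes G: "GTAI M n n X Y" and "0 < \<delta>"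
  shows "\<exists>K>0. \<forall>a\<ge>K. \<forall>x\<ge>K. \<forall>y\<ge>K. \<forall>k\<in>{1..n}. \<forall>l\<in>{1..n}.
           prob (crowded M X Y n k l a x y) \<le> \<delta> * J k l x y"
proof -
  (* The share of \<delta> for a single other variable; adding 1 keeps the denominator positive at n = 0. *)
  define \<eta> where "\<eta> = \<delta> / (2 * real n + 1)"
  have \<eta>: "0 < \<eta>" "2 * real n * \<eta> \<le> \<delta>"
    using \<open>0 < \<delta>\<close> by (auto simp: \<eta>_def field_simps)
  have X_ev: "\<forall>\<^sub>F (a, x, y) in at_top \<times>\<^sub>F at_top \<times>\<^sub>F at_top.
        \<P>(\<omega> in M. \<bar>X i \<omega>\<bar> > a \<bar> X k \<omega> > x \<and> Y l \<omega> > y) < \<eta>"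
    if "k \<in> {1..n}" "l \<in> {1..n}" "i \<in> {1..n} - {k}" for k l i
  proof -
    have "((\<lambda>(a, x, y). \<P>(\<omega> in M. \<bar>X i \<omega>\<bar> > a \<bar> X k \<omega> > x \<and> Y l \<omega> > y)) \<longlongrightarrow> 0)
          (at_top \<times>\<^sub>F at_top \<times>\<^sub>F at_top)"
      using G that unfolding GTAI_def by blast
    from order_tendstoD(2)[OF this \<eta>(1)] show ?thesis by (simp add: case_prod_unfold)
  qed
  have Y_ev: "\<forall>\<^sub>F (x, y, a) in at_top \<times>\<^sub>F at_top \<times>\<^sub>F at_top.
        \<P>(\<omega> in M. \<bar>Y j \<omega>\<bar> > a \<bar> X k \<omega> > x \<and> Y l \<omega> > y) < \<eta>"
    if "k \<in> {1..n}" "l \<in> {1..n}" "j \<in> {1..n} - {l}" for k l j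
  proof -
    have "((\<lambda>(x, y, a). \<P>(\<omega> in M. \<bar>Y j \<omega>\<bar> > a \<bar> X k \<omega> > x \<and> Y l \<omega> > y)) \<longlongrightarrow> 0)
          (at_top \<times>\<^sub>F at_top \<times>\<^sub>F at_top)"
      using G that unfolding GTAI_def by blast
    from order_tendstoD(2)[OF this \<eta>(1)] show ?thesis by (simp add: case_prod_unfold)
  qed
  have "\<forall>\<^sub>F (a, x, y) in at_top \<times>\<^sub>F at_top \<times>\<^sub>F at_top.
        \<forall>k\<in>{1..n}. \<forall>l\<in>{1..n}. \<forall>i\<in>{1..n} - {k}.
        \<P>(\<omega> in M. \<bar>X i \<omega>\<bar> > a \<bar> X k \<omega> > x \<and> Y l \<omega> > y) < \<eta>"
    using X_ev by (simp add: case_prod_unfold eventually_ball_finite_distrib)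
  then obtain K1 where K1: "0 < K1"
    "\<And>a x y. K1 \<le> a \<Longrightarrow> K1 \<le> x \<Longrightarrow> K1 \<le> y \<Longrightarrow>
      \<forall>k\<in>{1..n}. \<forall>l\<in>{1..n}. \<forall>i\<in>{1..n} - {k}.
        \<P>(\<omega> in M. \<bar>X i \<omega>\<bar> > a \<bar> X k \<omega> > x \<and> Y l \<omega> > y) < \<eta>"
    by (rule eventually_at_top_prod3E) (rule that)
  have "\<forall>\<^sub>F (x, y, a) in at_top \<times>\<^sub>F at_top \<times>\<^sub>F at_top.
        \<forall>k\<in>{1..n}. \<forall>l\<in>{1..n}. \<forall>j\<in>{1..n} - {l}.
        \<P>(\<omega> in M. \<bar>Y j \<omega>\<bar> > a \<bar> X k \<omega> > x \<and> Y l \<omega> > y) < \<eta>"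
    using Y_ev by (simp add: case_prod_unfold eventually_ball_finite_distrib)
  then obtain K2 where K2: "0 < K2"
    "\<And>x y a. K2 \<le> x \<Longrightarrow> K2 \<le> y \<Longrightarrow> K2 \<le> a \<Longrightarrow>
      \<forall>k\<in>{1..n}. \<forall>l\<in>{1..n}. \<forall>j\<in>{1..n} - {l}.
        \<P>(\<omega> in M. \<bar>Y j \<omega>\<bar> > a \<bar> X k \<omega> > x \<and> Y l \<omega> > y) < \<eta>"
    by (rule eventually_at_top_prod3E) (rule that)
  have "prob (crowded M X Y n k l a x y) \<le> \<delta> * J k l x y"
    if K: "a \<ge> max K1 K2" "x \<ge> max K1 K2" "y \<ge> max K1 K2" and kl: "k \<in> {1..n}" "l \<in> {1..n}"
    for a x y k l
  proof -
    let ?A = "\<lambda>i. {\<omega>\<in>space M. \<bar>X i \<omega>\<bar> > a \<and> X k \<omega> > x \<and> Y l \<omega> > y}"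
    let ?B = "\<lambda>j. {\<omega>\<in>space M. \<bar>Y j \<omega>\<bar> > a \<and> X k \<omega> > x \<and> Y l \<omega> > y}"
    note [measurable] = X_measurable[OF kl(1)] Y_measurable[OF kl(2)]
    have A: "prob (?A i) \<le> \<eta> * J k l x y" if i: "i \<in> {1..n} - {k}" for i
    proof -
      have [measurable]: "X i \<in> borel_measurable M" using X_measurable i by blast
      show ?thesis
        unfolding joint_tail_def
        by (rule cond_prob_lessD) (measurable, use K1(2) K kl i in simp)
    qed
    have B: "prob (?B j) \<le> \<eta> * J k l x y" if j: "j \<in> {1..n} - {l}" for j
    proof -
      have [measurable]: "Y j \<in> borel_measurable M" using Y_measurable j by blast
      show ?thesis
        unfolding joint_tail_def
        by (rule cond_prob_lessD) (measurable, use K2(2) K kl j in simp)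
    qed
    have UA: "prob (\<Union>i\<in>{1..n} - {k}. ?A i) \<le> (\<Sum>i\<in>{1..n} - {k}. prob (?A i))"
      using kl by (intro finite_measure_subadditive_finite) (auto intro!: other_X_sets)
    have UB: "prob (\<Union>j\<in>{1..n} - {l}. ?B j) \<le> (\<Sum>j\<in>{1..n} - {l}. prob (?B j))"
      using kl by (intro finite_measure_subadditive_finite) (auto intro!: other_Y_sets)
    have nonneg: "0 \<le> \<eta> * J k l x y" using \<eta>(1) joint_tail_nonneg by simp
    have SA: "(\<Sum>i\<in>{1..n} - {k}. prob (?A i)) \<le> real n * (\<eta> * J k l x y)"
    proof -
      have "(\<Sum>i\<in>{1..n} - {k}. prob (?A i)) \<le> real (card ({1..n} - {k})) * (\<eta> * J k l x y)"
        by (intro sum_bounded_above A)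
      also have "\<dots> \<le> real n * (\<eta> * J k l x y)"
        using nonneg by (intro mult_right_mono) (auto simp: card_Diff_subset_Int)
      finally show ?thesis .
    qed
    have SB: "(\<Sum>j\<in>{1..n} - {l}. prob (?B j)) \<le> real n * (\<eta> * J k l x y)"
    proof -
      have "(\<Sum>j\<in>{1..n} - {l}. prob (?B j)) \<le> real (card ({1..n} - {l})) * (\<eta> * J k l x y)"
        by (intro sum_bounded_above B)
      also have "\<dots> \<le> real n * (\<eta> * J k l x y)"
        using nonneg by (intro mult_right_mono) (auto simp: card_Diff_subset_Int)
      finally show ?thesis .
    qed
    have "prob (crowded M X Y n k l a x y)
        \<le> prob (\<Union>i\<in>{1..n} - {k}. ?A i) + prob (\<Union>j\<in>{1..n} - {l}. ?B j)"
      unfolding crowded_eq_Union using kl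
      by (intro measure_Un_le sets.finite_UN other_X_sets other_Y_sets) auto
    also have "\<dots> \<le> real n * (\<eta> * J k l x y) + real n * (\<eta> * J k l x y)"
      using UA UB SA SB by linarith
    also have "\<dots> = (2 * real n * \<eta>) * J k l x y" by (simp add: algebra_simps)
    also have "\<dots> \<le> \<delta> * J k l x y"
      using \<eta>(2) joint_tail_nonneg by (intro mult_right_mono) auto
    finally show ?thesis .
  qed
  then show ?thesis using K1(1) by (intro exI[of _ "max K1 K2"]) auto
qed

section \<open>Bounds for the probability of joint ruin\<close>

text \<open>
  The level \<open>a\<close> splits each portfolio into the cases of a jump beyond \<open>x - a\<close> and of two contributors.
  As \<open>X\<^sub>k > x / n\<close> and \<open>Y\<^sub>l > y / n\<close> hold in either case, one portfolio with a second contributor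
  suffices for a crowded event, and the mixed cases are covered.
\<close>
lemma both_ruined_subset:
  assumes "0 \<le> a" "0 \<le> x" "0 \<le> y"
  shows "both_ruined M X Y n x y \<subseteq> (\<Union>(k, l)\<in>{1..n} \<times> {1..n}.
     {\<omega>\<in>space M. X k \<omega> > x - a \<and> Y l \<omega> > y - a} \<union>
     crowded M X Y n k l (a / n) (x / n) (y / n))"
proof
  fix \<omega> assume "\<omega> \<in> both_ruined M X Y n x y"
  then obtain k' l' where \<omega>: "\<omega> \<in> space M" and k': "k' \<in> {1..n}" "x < (\<Sum>i=1..k'. X i \<omega>)"
      and l': "l' \<in> {1..n}" "y < (\<Sum>i=1..l'. Y i \<omega>)"
    by (auto simp: both_ruined_def)
  have "{1..k'} \<subseteq> {1..n}" using k'(1) by auto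
  from partial_sum_exceeds[OF finite_atLeastAtMost this assms(2,1) k'(2)]
  obtain k where k: "k \<in> {1..n}" "x / n < X k \<omega>"
      "x - a < X k \<omega> \<or> (\<exists>i\<in>{1..n} - {k}. a / n < \<bar>X i \<omega>\<bar>)"
    unfolding card_atLeastAtMost diff_Suc_1 by blast
  have "{1..l'} \<subseteq> {1..n}" using l'(1) by auto
  from partial_sum_exceeds[OF finite_atLeastAtMost this assms(3,1) l'(2)]
  obtain l where l: "l \<in> {1..n}" "y / n < Y l \<omega>"
      "y - a < Y l \<omega> \<or> (\<exists>j\<in>{1..n} - {l}. a / n < \<bar>Y j \<omega>\<bar>)"
    unfolding card_atLeastAtMost diff_Suc_1 by blast
  have "\<omega> \<in> {\<omega>\<in>space M. X k \<omega> > x - a \<and> Y l \<omega> > y - a} \<union>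
     crowded M X Y n k l (a / n) (x / n) (y / n)"
    using \<omega> k(2,3) l(2,3) by (auto simp: crowded_def)
  then show "\<omega> \<in> (\<Union>(k, l)\<in>{1..n} \<times> {1..n}. {\<omega>\<in>space M. X k \<omega> > x - a \<and> Y l \<omega> > y - a} \<union>
     crowded M X Y n k l (a / n) (x / n) (y / n))"
    using k(1) l(1) by blast
qed

lemma prob_both_ruined_le:
  assumes "0 \<le> a" "0 \<le> x" "0 \<le> y"
  shows "prob (both_ruined M X Y n x y) \<le> (\<Sum>k=1..n. \<Sum>l=1..n. J k l (x - a) (y - a) +
     prob (crowded M X Y n k l (a / n) (x / n) (y / n)))"
proof -
  let ?A = "\<lambda>k l. {\<omega>\<in>space M. X k \<omega> > x - a \<and> Y l \<omega> > y - a}"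
  let ?D = "\<lambda>k l. crowded M X Y n k l (a / n) (x / n) (y / n)"
  let ?S = "\<lambda>(k, l). ?A k l \<union> ?D k l"
  let ?I = "{1..n} \<times> {1..n}"
  have ev: "?S p \<in> events" if "p \<in> ?I" for p
    using that by (auto intro!: sets.Un exceed_sets crowded_sets)
  have "prob (both_ruined M X Y n x y) \<le> prob (\<Union>p\<in>?I. ?S p)"
    using both_ruined_subset[OF assms] ev by (intro finite_measure_mono sets.finite_UN) auto
  also have "\<dots> \<le> (\<Sum>p\<in>?I. prob (?S p))"
    using ev by (intro finite_measure_subadditive_finite) auto
  also have "\<dots> = (\<Sum>k=1..n. \<Sum>l=1..n. prob (?A k l \<union> ?D k l))"
    by (simp add: sum.cartesian_product case_prod_unfold)
  also have "\<dots> \<le> (\<Sum>k=1..n. \<Sum>l=1..n. J k l (x - a) (y - a) + prob (?D k l))"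
    unfolding joint_tail_def
    by (intro sum_mono measure_Un_le exceed_sets crowded_sets)
  finally show ?thesis .
qed

lemma prob_both_ruined_ge:
  assumes "0 < a" "0 \<le> x" "0 \<le> y"
  shows "(\<Sum>k=1..n. \<Sum>l=1..n. J k l (x + a) (y + a) -
     prob (crowded M X Y n k l (a / n) (x + a) (y + a))) \<le> prob (both_ruined M X Y n x y)"
proof -
  let ?A = "\<lambda>k l. {\<omega>\<in>space M. X k \<omega> > x + a \<and> Y l \<omega> > y + a}"
  let ?D = "\<lambda>k l. crowded M X Y n k l (a / n) (x + a) (y + a)"
  let ?S = "\<lambda>(k, l). ?A k l - ?D k l"
  let ?I = "{1..n} \<times> {1..n}"
  have ev: "?S p \<in> events" if "p \<in> ?I" for p
    using that by (auto intro!: sets.Diff exceed_sets crowded_sets)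
  have alone_X: "\<bar>X i \<omega>\<bar> \<le> a / n" if "\<omega> \<in> ?A k l - ?D k l" "i \<in> {1..n} - {k}" for \<omega> k l i
    using that by (auto simp: crowded_def not_less)
  have alone_Y: "\<bar>Y j \<omega>\<bar> \<le> a / n" if "\<omega> \<in> ?A k l - ?D k l" "j \<in> {1..n} - {l}" for \<omega> k l j
    using that by (auto simp: crowded_def not_less)
  (* The selected indices are the only ones with absolute value above a / n, hence they are determined. *)
  have disj: "disjoint_family_on ?S ?I"
  proof (unfold disjoint_family_on_def, intro ballI impI, rule ccontr)
    fix p q assume p: "p \<in> ?I" and q: "q \<in> ?I" and "p \<noteq> q" and "?S p \<inter> ?S q \<noteq> {}"
    obtain k l k' l' where kl: "p = (k, l)" "q = (k', l')" by (cases p, cases q) auto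
    obtain \<omega> where \<omega>: "\<omega> \<in> ?A k l - ?D k l" "\<omega> \<in> ?A k' l' - ?D k' l'"
      using \<open>?S p \<inter> ?S q \<noteq> {}\<close> unfolding kl by blast
    have "n > 0" using p by auto
    then have "a / n \<le> a" using \<open>0 < a\<close> by (simp add: field_simps)
    then have big: "a / n < X k \<omega>" "a / n < Y l \<omega>" using \<omega>(1) assms by auto
    consider "k \<noteq> k'" | "l \<noteq> l'" using \<open>p \<noteq> q\<close> kl by auto
    then show False
    proof cases
      case 1
      then have "\<bar>X k \<omega>\<bar> \<le> a / n" using p kl by (intro alone_X[OF \<omega>(2)]) auto
      then show False using big by linarith
    next
      case 2
      then have "\<bar>Y l \<omega>\<bar> \<le> a / n" using p kl by (intro alone_Y[OF \<omega>(2)]) auto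
      then show False using big by linarith
    qed
  qed
  have sub: "(\<Union>p\<in>?I. ?S p) \<subseteq> both_ruined M X Y n x y"
  proof
    fix \<omega> assume "\<omega> \<in> (\<Union>p\<in>?I. ?S p)"
    then obtain k l where kl: "k \<in> {1..n}" "l \<in> {1..n}" and \<omega>: "\<omega> \<in> ?A k l - ?D k l" by auto
    have "x < (\<Sum>i=1..n. X i \<omega>)"
      using \<omega> kl assms alone_X[OF \<omega>] by (intro single_big_summand[where k = k and a = a]) auto
    moreover have "y < (\<Sum>j=1..n. Y j \<omega>)"
      using \<omega> kl assms alone_Y[OF \<omega>] by (intro single_big_summand[where k = l and a = a]) auto
    moreover have "n \<in> {1..n}" using kl by auto
    ultimately show "\<omega> \<in> both_ruined M X Y n x y"
      using \<omega> unfolding both_ruined_def by blast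
  qed
  have "(\<Sum>k=1..n. \<Sum>l=1..n. J k l (x + a) (y + a) - prob (?D k l))
      \<le> (\<Sum>k=1..n. \<Sum>l=1..n. prob (?A k l - ?D k l))"
  proof (intro sum_mono)
    fix k l assume kl: "k \<in> {1..n}" "l \<in> {1..n}"
    have "?D k l \<subseteq> ?A k l" by (auto simp: crowded_def)
    then show "J k l (x + a) (y + a) - prob (?D k l) \<le> prob (?A k l - ?D k l)"
      using kl by (simp add: finite_measure_Diff exceed_sets crowded_sets joint_tail_def)
  qed
  also have "\<dots> = (\<Sum>p\<in>?I. prob (?S p))"
    by (simp add: sum.cartesian_product case_prod_unfold)
  also have "\<dots> = prob (\<Union>p\<in>?I. ?S p)"
    using ev disj by (intro finite_measure_finite_Union[symmetric]) auto
  also have "\<dots> \<le> prob (both_ruined M X Y n x y)"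
    using sub both_ruined_sets by (rule finite_measure_mono)
  finally show ?thesis .
qed

section \<open>Asymptotics of joint ruin\<close>

text \<open>
  The order of the choices matters: first a constant \<open>B\<close> for the dominated variation of all pairs,
  then \<open>\<delta>\<close> so that \<open>\<delta> B\<close> is small, then the level \<open>a\<close> from \<open>crowded_negligible\<close> for this \<open>\<delta>\<close>, and only then, for the
  now constant \<open>a\<close>, the threshold of long-tailedness. Half of \<open>\<epsilon>\<close> pays for the shift and half for
  the crowded events.
\<close>
lemma both_ruined_asymptotics:
  assumes "0 < n"
    and pos: "\<And>k l x y. k \<in> {1..n} \<Longrightarrow> l \<in> {1..n} \<Longrightarrow> 0 \<le> x \<Longrightarrow> 0 \<le> y \<Longrightarrow> 0 < J k l x y"
    and G: "GTAI M n n X Y"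
    and D: "\<And>k l. k \<in> {1..n} \<Longrightarrow> l \<in> {1..n} \<Longrightarrow> dominatedly_varying2 M (X k) (Y l)"
    and L: "\<And>k l. k \<in> {1..n} \<Longrightarrow> l \<in> {1..n} \<Longrightarrow> long_tailed2 M (X k) (Y l)"
    and "0 < \<epsilon>"
  shows "\<forall>\<^sub>F (x, y) in at_top \<times>\<^sub>F at_top.
     \<bar>prob (both_ruined M X Y n x y) - (\<Sum>k=1..n. \<Sum>l=1..n. J k l x y)\<bar>
       \<le> \<epsilon> * (\<Sum>k=1..n. \<Sum>l=1..n. J k l x y)"
proof -
  define scales where "scales k l C \<longleftrightarrow>
      0 \<le> C \<and> (\<forall>\<^sub>F (x, y) in at_top \<times>\<^sub>F at_top. J k l (x / n) (y / n) \<le> C * J k l x y)" for k l C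
  have "\<exists>C. scales k l C" if "k \<in> {1..n}" "l \<in> {1..n}" for k l
    using joint_tail_scale_bound[OF X_measurable[OF that(1)] Y_measurable[OF that(2)] pos[OF that]
        D[OF that], of "1 / n"] \<open>0 < n\<close>
    by (auto simp: scales_def)
  then obtain C where C_scales: "\<And>k l. k \<in> {1..n} \<Longrightarrow> l \<in> {1..n} \<Longrightarrow> scales k l (C k l)"
    by metis
  have C: "0 \<le> C k l" "\<forall>\<^sub>F (x, y) in at_top \<times>\<^sub>F at_top. J k l (x / n) (y / n) \<le> C k l * J k l x y"
    if "k \<in> {1..n}" "l \<in> {1..n}" for k l
    using C_scales[OF that] by (simp_all add: scales_def)
  define B where "B = 1 + (\<Sum>k=1..n. \<Sum>l=1..n. C k l)"
  have "B \<ge> 1" using C(1) by (auto simp: B_def intro!: sum_nonneg)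
  have CB: "C k l \<le> B" if "k \<in> {1..n}" "l \<in> {1..n}" for k l
  proof -
    have "C k l \<le> (\<Sum>l=1..n. C k l)"
      using that C(1) by (intro member_le_sum) auto
    also have "\<dots> \<le> (\<Sum>k=1..n. \<Sum>l=1..n. C k l)"
      using that C(1) by (intro member_le_sum[where f = "\<lambda>k. \<Sum>l=1..n. C k l"] sum_nonneg) auto
    finally show ?thesis by (simp add: B_def)
  qed
  have "\<forall>\<^sub>F (x, y) in at_top \<times>\<^sub>F at_top. \<forall>k\<in>{1..n}. \<forall>l\<in>{1..n}.
      J k l (x / n) (y / n) \<le> C k l * J k l x y"
    using C(2) by (simp add: case_prod_unfold eventually_ball_finite_distrib)
  then obtain K1 where K1: "0 < K1" "\<And>x y. K1 \<le> x \<Longrightarrow> K1 \<le> y \<Longrightarrow>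
      \<forall>k\<in>{1..n}. \<forall>l\<in>{1..n}. J k l (x / n) (y / n) \<le> C k l * J k l x y"
    by (rule eventually_at_top_prodE) (rule that)
  define \<delta> where "\<delta> = \<epsilon> / (2 * B)"
  have \<delta>: "0 < \<delta>" "\<delta> * B = \<epsilon> / 2" "\<delta> \<le> \<epsilon> / 2"
    using \<open>0 < \<epsilon>\<close> \<open>B \<ge> 1\<close> by (auto simp: \<delta>_def field_simps)
  obtain K2 where K2: "K2 > 0" "\<And>a x y k l. a \<ge> K2 \<Longrightarrow> x \<ge> K2 \<Longrightarrow> y \<ge> K2 \<Longrightarrow> k \<in> {1..n} \<Longrightarrow>
      l \<in> {1..n} \<Longrightarrow> prob (crowded M X Y n k l a x y) \<le> \<delta> * J k l x y"
    using crowded_negligible[OF G \<delta>(1)] by blast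
  (* Then a / n is the threshold K2 itself, and so x / n and y / n are beyond it once x, y \<ge> a. *)
  define a where "a = K2 * n"
  have a: "0 < a" "a / n = K2" "K2 \<le> a"
    using K2(1) \<open>0 < n\<close> by (auto simp: a_def)
  have "\<forall>\<^sub>F (x, y) in at_top \<times>\<^sub>F at_top. \<forall>k\<in>{1..n}. \<forall>l\<in>{1..n}.
      J k l (x - a) (y - a) \<le> (1 + \<delta>) * J k l x y"
    using joint_tail_shift_bound[OF pos L a(1) \<delta>(1)]
    by (simp add: case_prod_unfold eventually_ball_finite_distrib)
  then obtain K3 where K3: "0 < K3" "\<And>x y. K3 \<le> x \<Longrightarrow> K3 \<le> y \<Longrightarrow>
      \<forall>k\<in>{1..n}. \<forall>l\<in>{1..n}. J k l (x - a) (y - a) \<le> (1 + \<delta>) * J k l x y"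
    by (rule eventually_at_top_prodE) (rule that)
  define K where "K = max (max K1 K3) a"
  have "K > 0" using K1(1) by (simp add: K_def)
  have "\<bar>prob (both_ruined M X Y n x y) - (\<Sum>k=1..n. \<Sum>l=1..n. J k l x y)\<bar>
       \<le> \<epsilon> * (\<Sum>k=1..n. \<Sum>l=1..n. J k l x y)"
    if x: "x \<ge> K" and y: "y \<ge> K" for x y
  proof -
    have x': "K1 \<le> x" "K3 \<le> x" "a \<le> x" and y': "K1 \<le> y" "K3 \<le> y" "a \<le> y"
      using x y by (auto simp: K_def)
    have "a / n \<le> x / n" "a / n \<le> y / n"
      using x'(3) y'(3) by (auto intro: divide_right_mono)
    then have cx: "K2 \<le> x / n" "K2 \<le> y / n" using a(2) by simp_all
    have upper: "J k l (x - a) (y - a) + prob (crowded M X Y n k l (a / n) (x / n) (y / n))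
        \<le> (1 + \<epsilon>) * J k l x y" if kl: "k \<in> {1..n}" "l \<in> {1..n}" for k l
    proof -
      have "prob (crowded M X Y n k l (a / n) (x / n) (y / n)) \<le> \<delta> * J k l (x / n) (y / n)"
        using a(2) cx kl by (intro K2(2)) auto
      also have "\<dots> \<le> \<delta> * (C k l * J k l x y)"
        using K1(2)[OF x'(1) y'(1)] kl \<delta>(1) by (intro mult_left_mono) auto
      also have "\<dots> \<le> \<delta> * (B * J k l x y)"
        using CB[OF kl] \<delta>(1) joint_tail_nonneg by (intro mult_left_mono mult_right_mono) auto
      also have "\<dots> = \<epsilon> / 2 * J k l x y" using \<delta>(2) by (simp flip: mult.assoc)
      finally have 1: "prob (crowded M X Y n k l (a / n) (x / n) (y / n)) \<le> \<epsilon> / 2 * J k l x y" .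
      have "J k l (x - a) (y - a) \<le> (1 + \<delta>) * J k l x y"
        using K3(2)[OF x'(2) y'(2)] kl by blast
      also have "\<dots> \<le> (1 + \<epsilon> / 2) * J k l x y"
        using \<delta>(3) joint_tail_nonneg by (intro mult_right_mono) auto
      finally show ?thesis using 1 by (simp add: algebra_simps)
    qed
    have lower: "(1 - \<epsilon>) * J k l x y \<le>
        J k l (x + a) (y + a) - prob (crowded M X Y n k l (a / n) (x + a) (y + a))"
      if kl: "k \<in> {1..n}" "l \<in> {1..n}" for k l
    proof -
      have mono: "J k l (x + a) (y + a) \<le> J k l x y"
        using a(1) X_measurable[OF kl(1)] Y_measurable[OF kl(2)]
        by (intro joint_tail_antimono) auto
      have "prob (crowded M X Y n k l (a / n) (x + a) (y + a)) \<le> \<delta> * J k l (x + a) (y + a)"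
        using a x' y' kl by (intro K2(2)) auto
      moreover have "J k l x y \<le> (1 + \<delta>) * J k l (x + a) (y + a)"
        using K3(2)[of "x + a" "y + a"] x' y' a(1) kl by simp
      moreover have "2 * \<delta> * J k l (x + a) (y + a) \<le> \<epsilon> * J k l x y"
        using mono \<delta> joint_tail_nonneg by (intro mult_mono) auto
      ultimately show ?thesis by (simp add: algebra_simps)
    qed
    have "prob (both_ruined M X Y n x y) \<le> (\<Sum>k=1..n. \<Sum>l=1..n. J k l (x - a) (y - a) +
        prob (crowded M X Y n k l (a / n) (x / n) (y / n)))"
      using a(1) x'(3) y'(3) by (intro prob_both_ruined_le) auto
    also have "\<dots> \<le> (\<Sum>k=1..n. \<Sum>l=1..n. (1 + \<epsilon>) * J k l x y)"
      by (intro sum_mono upper)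
    finally have le: "prob (both_ruined M X Y n x y) \<le> (1 + \<epsilon>) * (\<Sum>k=1..n. \<Sum>l=1..n. J k l x y)"
      by (simp only: sum_distrib_left)
    have "(1 - \<epsilon>) * (\<Sum>k=1..n. \<Sum>l=1..n. J k l x y) = (\<Sum>k=1..n. \<Sum>l=1..n. (1 - \<epsilon>) * J k l x y)"
      by (simp only: sum_distrib_left)
    also have "\<dots> \<le> (\<Sum>k=1..n. \<Sum>l=1..n. J k l (x + a) (y + a) -
        prob (crowded M X Y n k l (a / n) (x + a) (y + a)))"
      by (intro sum_mono lower)
    also have "\<dots> \<le> prob (both_ruined M X Y n x y)"
      using x' y' a(1) by (intro prob_both_ruined_ge) auto
    finally show ?thesis using le by (simp add: abs_le_iff algebra_simps)
  qed
  then show ?thesis using \<open>K > 0\<close> by (auto simp: eventually_at_top_prod_iff)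
qed

end

theorem corollary4p2:
  fixes M :: "'a measure" and X Y :: "nat \<Rightarrow> 'a \<Rightarrow> real" and n :: nat
  assumes "prob_space M"
    and "n \<ge> 1"
    and "\<And>k. k \<in> {1..n} \<Longrightarrow> X k \<in> borel_measurable M"
    and "\<And>l. l \<in> {1..n} \<Longrightarrow> Y l \<in> borel_measurable M"
    and "\<And>k x. k \<in> {1..n} \<Longrightarrow> x \<ge> 0 \<Longrightarrow> tail (distr M borel (X k)) x > 0"
    and "\<And>l y. l \<in> {1..n} \<Longrightarrow> y \<ge> 0 \<Longrightarrow> tail (distr M borel (Y l)) y > 0"
    and "\<And>k l x y. k \<in> {1..n} \<Longrightarrow> l \<in> {1..n} \<Longrightarrow> x \<ge> 0 \<Longrightarrow> y \<ge> 0 \<Longrightarrow>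
           joint_tail M (X k) (Y l) x y > 0"
    and "\<And>k. k \<in> {1..n} \<Longrightarrow>
           dominatedly_varying (distr M borel (X k)) \<and> long_tailed (distr M borel (X k))"
    and "\<And>l. l \<in> {1..n} \<Longrightarrow>
           dominatedly_varying (distr M borel (Y l)) \<and> long_tailed (distr M borel (Y l))"
    and "GTAI M n n X Y"
    and "\<And>k l. k \<in> {1..n} \<Longrightarrow> l \<in> {1..n} \<Longrightarrow>
           dominatedly_varying2 M (X k) (Y l) \<and> long_tailed2 M (X k) (Y l)"
    and "TAI M n X"
    and "TAI M n Y"
  shows "((\<lambda>(x, y). psi_and M X Y x y n /
            (\<Sum>k=1..n. \<Sum>l=1..n. \<P>(\<omega> in M. X k \<omega> > x \<and> Y l \<omega> > y))) \<longlongrightarrow> 1)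
           (at_top \<times>\<^sub>F at_top)"
proof -
  interpret two_portfolios M X Y n
    using assms(1,3,4) by (simp add: two_portfolios_def two_portfolios_axioms_def)
  let ?\<psi> = "\<lambda>x y. prob (both_ruined M X Y n x y)"
  let ?S = "\<lambda>x y. \<Sum>k=1..n. \<Sum>l=1..n. J k l x y"
  have psi: "psi_and M X Y x y n = ?\<psi> x y" for x y
    by (simp only: psi_and_def both_ruined_def T_and_le_iff)
  have S_pos: "0 < ?S x y" if "0 \<le> x" "0 \<le> y" for x y
    using assms(2,7) that by (intro sum_pos) auto
  have "((\<lambda>(x, y). ?\<psi> x y / ?S x y) \<longlongrightarrow> 1) (at_top \<times>\<^sub>F at_top)"
  proof (rule tendstoI)
    fix e :: real assume "0 < e"
    have "\<forall>\<^sub>F (x, y) in at_top \<times>\<^sub>F at_top. \<bar>?\<psi> x y - ?S x y\<bar> \<le> e / 2 * ?S x y"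
      using assms(2,7,10,11) \<open>0 < e\<close> by (intro both_ruined_asymptotics) auto
    then obtain K where K: "0 < K" "\<And>x y. K \<le> x \<Longrightarrow> K \<le> y \<Longrightarrow> \<bar>?\<psi> x y - ?S x y\<bar> \<le> e / 2 * ?S x y"
      by (rule eventually_at_top_prodE) (rule that)
    have "dist (?\<psi> x y / ?S x y) 1 < e" if "x \<ge> K" "y \<ge> K" for x y
    proof -
      have S: "0 < ?S x y" using that K(1) by (intro S_pos) auto
      then have "?\<psi> x y / ?S x y - 1 = (?\<psi> x y - ?S x y) / ?S x y"
        by (simp add: diff_divide_distrib)
      then have "dist (?\<psi> x y / ?S x y) 1 = \<bar>?\<psi> x y - ?S x y\<bar> / ?S x y"
        using S by (simp add: dist_real_def)
      also have "\<dots> \<le> e / 2" using K(2)[OF that] S by (simp add: divide_le_eq)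
      finally show ?thesis using \<open>0 < e\<close> by simp
    qed
    then show "\<forall>\<^sub>F p in at_top \<times>\<^sub>F at_top. dist ((\<lambda>(x, y). ?\<psi> x y / ?S x y) p) 1 < e"
      unfolding eventually_at_top_prod_iff case_prod_conv using K(1) by blast
  qed
  then show ?thesis by (simp only: psi joint_tail_def)
qed

end
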